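(* Let $m,n,p,q$ be nonnegative integers with $p\ge mn$ and $q\ge 1$. Then there is a bijection between $\Gamma_{p+q+mn,n}^{(p)}$ and $\Gamma_{p+q+mn,n}^{(p+1)}$; in particular these two sets have the same cardinality.
   Context: Let $\Gamma=\{a,b\}$ be a two-letter alphabet graded by $\|a\|=1$ and $\|b\|=m+1$. For a word $w=w_1\cdots w_\ell\in\Gamma^*$ its weight is $\|w\|=\|w_1\|+\cdots+\|w_\ell\|$ (the empty word has weight $0$), and $|w|_b$ is the number of letters of $w$ equal to $b$. For integers $P,k$ let $\Gamma_{P,k}=\{w\in\Gamma^*:\ \|w\|=P,\ |w|_b=k\}$. For an integer $r$, let $\Gamma_{P,k}^{(r)}$ be the set of words $w\in\Gamma_{P,k}$ that have a prefix (a word $w_1\cdots w_i$, $0\le i\le\ell$) of weight exactly $r$. *)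

theory Defs
  imports Main "HOL-Library.Sublist"
begin

datatype letter = a | b

fun letter_weight :: "nat \<Rightarrow> letter \<Rightarrow> nat" where
  "letter_weight m a = 1"
| "letter_weight m b = m + 1"

definition weight :: "nat \<Rightarrow> letter list \<Rightarrow> nat" where
  "weight m w = (\<Sum>x\<leftarrow>w. letter_weight m x)"

text \<open>The grading depends on \<open>m\<close>, so \<open>m\<close> is an explicit first argument throughout.\<close>

definition Gam :: "nat \<Rightarrow> nat \<Rightarrow> nat \<Rightarrow> letter list set" where
  "Gam m P k = {w. weight m w = P \<and> count_list w b = k}"

definition Gam_pre :: "nat \<Rightarrow> nat \<Rightarrow> nat \<Rightarrow> nat \<Rightarrow> letter list set" where
  "Gam_pre m P k r = {w \<in> Gam m P k. \<exists>u. prefix u w \<and> weight m u = r}"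

hide_const (open) a b

end

theory Submission
  imports Defs
begin

text \<open>A word with a prefix of weight \<open>r\<close> is the same as a pair of words, cut at weight \<open>r\<close>. Compare
  the words cut at \<open>p\<close> with those cut at \<open>p + 1\<close>: those with an \<open>a\<close> between the two cuts are common
  to both. The others have a \<open>b\<close> starting at weight \<open>p\<close>, respectively ending at weight \<open>p + 1\<close>;
  deleting this \<open>b\<close> leaves words with one \<open>b\<close> fewer, cut at \<open>p\<close> and at \<open>p - m\<close> respectively, and
  these are equinumerous by \<open>m\<close> applications of the induction hypothesis.\<close>

lemma weight_simps [simp]:
  "weight m [] = 0"
  "weight m (x # w) = letter_weight m x + weight m w"
  "weight m (u @ v) = weight m u + weight m v"
  by (simp_all add: weight_def)

lemma letter_weight_pos: "0 < letter_weight m x"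
  by (cases x) auto

lemma length_le_weight: "length w \<le> weight m w"
proof (induction w)
  case (Cons x w)
  then show ?case using letter_weight_pos[of m x] by simp
qed simp

lemma weight_eq_0_iff [simp]: "weight m w = 0 \<longleftrightarrow> w = []"
  using length_le_weight[of w m] by auto

lemma finite_letter_lists_weight: "finite {w. weight m w = r}"
proof (rule finite_subset)
  have UNIV: "(UNIV :: letter set) = {letter.a, letter.b}"
    using letter.exhaust by blast
  show "{w. weight m w = r} \<subseteq> {w. set w \<subseteq> UNIV \<and> length w \<le> r}"
    using length_le_weight by auto
  show "finite {w :: letter list. set w \<subseteq> UNIV \<and> length w \<le> r}"
    by (rule finite_lists_length_le) (simp add: UNIV)
qed

definition cuts :: "nat \<Rightarrow> nat \<Rightarrow> nat \<Rightarrow> nat \<Rightarrow> (letter list \<times> letter list) set" where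
  "cuts m r s k = {(u, v). weight m u = r \<and> weight m v = s \<and>
     count_list u letter.b + count_list v letter.b = k}"

lemma finite_cuts [simp]: "finite (cuts m r s k)"
proof (rule finite_subset)
  show "cuts m r s k \<subseteq> {w. weight m w = r} \<times> {w. weight m w = s}"
    by (auto simp: cuts_def)
qed (simp add: finite_letter_lists_weight)

text \<open>One of \<open>u\<close>, \<open>u'\<close> extends the other by a word of weight 0, and
  letters have positive weight, so that word is empty.\<close>

lemma append_eq_append_weight_eq:
  assumes "u @ v = u' @ v'" "weight m u = weight m u'"
  shows "u = u' \<and> v = v'"
  using assms by (auto simp: append_eq_append_conv2)

lemma bij_betw_cuts_Gam_pre:
  "bij_betw (\<lambda>(u, v). u @ v) (cuts m r s k) (Gam_pre m (r + s) k r)"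
  unfolding bij_betw_def
proof
  show "inj_on (\<lambda>(u, v). u @ v) (cuts m r s k)"
    by (auto simp: inj_on_def cuts_def dest: append_eq_append_weight_eq[where m = m])
  show "(\<lambda>(u, v). u @ v) ` cuts m r s k = Gam_pre m (r + s) k r"
    by (force simp: cuts_def Gam_pre_def Gam_def prefix_def image_iff)
qed

text \<open>Split by the first letter of the right word, which is nonempty because its weight is
  positive. Removing a \<open>b\<close> leaves weight \<open>s - m\<close>; the guard
  \<open>m \<le> s\<close> keeps this from being truncated.\<close>

lemma card_cuts_Suc_right:
  "card (cuts m r (Suc s) k) = card (cuts m r s k) +
     (if 0 < k \<and> m \<le> s then card (cuts m r (s - m) (k - 1)) else 0)"
proof -
  let ?A = "apsnd (Cons letter.a) ` cuts m r s k"
  let ?B = "if 0 < k \<and> m \<le> s then apsnd (Cons letter.b) ` cuts m r (s - m) (k - 1) else {}"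
  have "x \<in> cuts m r (Suc s) k \<longleftrightarrow> x \<in> ?A \<union> ?B" for x
  proof (cases x)
    case (Pair u v)
    show ?thesis
    proof (cases v)
      case (Cons c w)
      then show ?thesis using Pair by (cases c) (auto simp: cuts_def image_iff)
    qed (use Pair in \<open>auto simp: cuts_def\<close>)
  qed
  then have "cuts m r (Suc s) k = ?A \<union> ?B"
    by blast
  moreover have "card (?A \<union> ?B) = card ?A + card ?B"
    by (rule card_Un_disjoint) auto
  moreover have "card (apsnd (Cons c) ` X) = card X" for c and X :: "(letter list \<times> letter list) set"
    by (rule card_image) (auto simp: inj_on_def)
  ultimately show ?thesis
    by simp
qed

text \<open>Mirror image: split by the last letter of the left word.\<close>

lemma card_cuts_Suc_left:
  "card (cuts m (Suc r) s k) = card (cuts m r s k) +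
     (if 0 < k \<and> m \<le> r then card (cuts m (r - m) s (k - 1)) else 0)"
proof -
  let ?f = "\<lambda>c. apfst (\<lambda>u. u @ [c])"
  let ?A = "?f letter.a ` cuts m r s k"
  let ?B = "if 0 < k \<and> m \<le> r then ?f letter.b ` cuts m (r - m) s (k - 1) else {}"
  have "x \<in> cuts m (Suc r) s k \<longleftrightarrow> x \<in> ?A \<union> ?B" for x
  proof (cases x)
    case (Pair u v)
    show ?thesis
    proof (cases u rule: rev_cases)
      case (snoc w c)
      then show ?thesis using Pair by (cases c) (auto simp: cuts_def image_iff)
    qed (use Pair in \<open>auto simp: cuts_def\<close>)
  qed
  then have "cuts m (Suc r) s k = ?A \<union> ?B"
    by blast
  moreover have "card (?A \<union> ?B) = card ?A + card ?B"
    by (rule card_Un_disjoint) auto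
  moreover have "card (?f c ` X) = card X" for c and X :: "(letter list \<times> letter list) set"
    by (rule card_image) (auto simp: inj_on_def)
  ultimately show ?thesis
    by simp
qed

lemma card_cuts_shift:
  assumes "m * k \<le> r" "m * k \<le> s"
  shows "card (cuts m r (Suc s) k) = card (cuts m (Suc r) s k)"
  using assms
proof (induction k arbitrary: r s)
  case 0
  then show ?case by (simp add: card_cuts_Suc_left card_cuts_Suc_right)
next
  case (Suc k)
  note IH = Suc.IH
  \<comment> \<open>Each use of \<open>IH\<close> moves one unit of weight across the cut. The left
    weight grows on the way, so \<open>r\<close> is generalised.\<close>
  have shift: "card (cuts m r (s + j) k) = card (cuts m (r + j) s k)"
    if "m * k \<le> r" "m * k \<le> s" for r s j
    using that
  proof (induction j arbitrary: r)
    case (Suc j)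
    then show ?case using Suc.IH[of "Suc r"] IH[of r "s + j"]
      by simp
  qed simp
  \<comment> \<open>The \<open>a\<close> terms agree. The \<open>b\<close> terms differ by moving
    \<open>m\<close> units across the cut, and \<open>m * Suc k \<le> r\<close> gives
    \<open>m * k \<le> r - m\<close>, likewise for \<open>s\<close>.\<close>
  show ?case
    using Suc.prems shift[of "r - m" "s - m" m]
    by (simp add: card_cuts_Suc_left card_cuts_Suc_right)
qed

theorem theorem2p2:
  fixes m n p q :: nat
  assumes "p \<ge> m * n" and "q \<ge> 1"
  shows "(\<exists>f. bij_betw f (Gam_pre m (p + q + m * n) n p) (Gam_pre m (p + q + m * n) n (p + 1)))
    \<and> card (Gam_pre m (p + q + m * n) n p) = card (Gam_pre m (p + q + m * n) n (p + 1))"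
proof -
  \<comment> \<open>Weight right of the cut at \<open>p + 1\<close>; by \<open>q \<ge> 1\<close>,
    \<open>Suc ?s\<close> is the weight right of the cut at \<open>p\<close>.\<close>
  let ?s = "q - 1 + m * n"
  have P: "bij_betw (\<lambda>(u, v). u @ v) (cuts m p (Suc ?s) n) (Gam_pre m (p + q + m * n) n p)"
    using bij_betw_cuts_Gam_pre[of m p "Suc ?s" n] assms(2) by (simp add: add.assoc)
  have Q: "bij_betw (\<lambda>(u, v). u @ v) (cuts m (Suc p) ?s n) (Gam_pre m (p + q + m * n) n (p + 1))"
    using bij_betw_cuts_Gam_pre[of m "Suc p" ?s n] assms(2) by (simp add: add.assoc)
  have card: "card (Gam_pre m (p + q + m * n) n p) = card (Gam_pre m (p + q + m * n) n (p + 1))"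
    using card_cuts_shift[of m n p ?s] assms(1) bij_betw_same_card[OF P] bij_betw_same_card[OF Q]
    by simp
  moreover have "finite (Gam_pre m (p + q + m * n) n p)" "finite (Gam_pre m (p + q + m * n) n (p + 1))"
    using bij_betw_finite[OF P] bij_betw_finite[OF Q] by simp_all
  ultimately show ?thesis
    using finite_same_card_bij by blast
qed

end
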